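(* Let $A\in\mathbb{R}^{m\times n}$, let $b\in\mathbb{R}^m$ be nonzero, let $k\le s\le n$, and let $Z=Z_k^{(p)}\in\mathbb{R}^{n\times k}$ be generated by $k$ steps of the flexible Golub--Kahan factorization with partial orthogonalization (as described in the context) applied to $A$ with starting vector $b/\|b\|_2$. Let $r_k^{\mathrm{opt}}=\min_{y\in\mathbb{R}^k}\|AZy-b\|_2$. Let $Q$ be a matrix with orthonormal columns spanning $\mathrm{range}(AZ)$, and let $Q_\perp$ be a matrix whose columns form an orthonormal basis of the orthogonal complement of $\mathrm{range}(AZ)$ in $\mathbb{R}^m$. Let $S\in\mathbb{R}^{s\times m}$ be the sketching matrix used in sFLSQR and $\widetilde S\in\mathbb{R}^{s\times n}$ the sketching matrix used in sFLSMR, and let $r_k^{\mathrm{sFLSQR}}$ and $r_k^{\mathrm{sFLSMR}}$ be the corresponding residual norms $$r_k^{\mathrm{sFLSQR}}=\|AZ\,y_k^{\mathrm{sFLSQR}}-b\|_2,\qquad y_k^{\mathrm{sFLSQR}}=\arg\min_{y\in\mathbb{R}^k}\|S(AZy-b)\|_2,$$ $$r_k^{\mathrm{sFLSMR}}=\|AZ\,y_k^{\mathrm{sFLSMR}}-b\|_2,\qquad y_k^{\mathrm{sFLSMR}}=\arg\min_{y\in\mathbb{R}^k}\|\widetilde S(A^\top AZy-A^\top b)\|_2.$$ If $SAZ\in\mathbb{R}^{s\times k}$ and $\widetilde S A^\top AZ\in\mathbb{R}^{s\times k}$ are full rank (i.e. of rank $k$), then $$r_k^{\mathrm{sFLSQR}}\le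 r_k^{\mathrm{opt}}\sqrt{1+\|(SQ)^\dagger SQ_\perp\|_2^2},$$ $$r_k^{\mathrm{sFLSMR}}\le r_k^{\mathrm{opt}}\sqrt{1+\|(\widetilde SA^\top Q)^\dagger \widetilde SA^\top Q_\perp\|_2^2}.$$
   Context: $\|\cdot\|_2$ is the Euclidean norm of vectors and the spectral norm of matrices (equal to $0$ for an empty matrix); $M^\dagger$ is the Moore--Penrose pseudoinverse. Flexible Golub--Kahan (FGK) factorization with partial orthogonalization: let $\tau:\mathbb{R}^n\to\mathbb{R}^n$ be a given (possibly nonlinear) map and $\ell$ a given orthogonalization window. Start from $w_1=b/\|b\|_2$. For $j=1,\dots,k$: form $A^\top w_j$, orthogonalize it only against the last (at most) $\ell$ of the previous vectors $p_i$, $i<j$, and normalize to obtain $p_j$; set $z_j=\tau(p_j)$; form $Az_j$, orthogonalize it only against the most recent vectors $w_i$, $\max(1,j-\ell)\le i\le j$, and normalize to obtain $w_{j+1}$. (It is assumed that no breakdown, i.e. normalization of a zero vector, occurs.) With $P_k^{(p)}=[p_1,\dots,p_k]$, $W_k^{(p)}=[w_1,\dots,w_k]$, $Z_k^{(p)}=[z_1,\dots,z_k]$, this gives the relations $$A^\top W_k^{(p)}=P_k^{(p)}T_k^{(p)},\qquad AZ_k^{(p)}=W_{k+1}^{(p)}H_{k+1,k}^{(p)},\qquad Z_k^{(p)}=\tau(P_k^{(p)})\ \text{(columnwise)},$$ with $T_k^{(p)}\in\mathbb{R}^{k\times k}$ banded upper triangular and $H_{k+1,k}^{(p)}\in\mathbb{R}^{(k+1)\times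 k}$ banded upper Hessenberg. In general the columns of $P_k^{(p)}$ and of $W_k^{(p)}$ are not orthonormal. The $k$th sFLSQR and sFLSMR approximate solutions of $\min_x\|Ax-b\|_2$ are $x_k^{\mathrm{sFLSQR}}=Z_k^{(p)}y_k^{\mathrm{sFLSQR}}$ and $x_k^{\mathrm{sFLSMR}}=Z_k^{(p)}y_k^{\mathrm{sFLSMR}}$, with coefficient vectors as given in the claim. *)

theory Defs
  imports Complex_Main "Jordan_Normal_Form.DL_Rank"
begin

text \<open>
  Matrices and vectors are those of \<^theory>\<open>Jordan_Normal_Form.Matrix\<close>, since they may be empty
  (for instance, \<open>Q\<^sub>\<perp>\<close> has no columns if \<open>range (A Z)\<close> is the whole space).
\<close>

definition enorm :: "real vec \<Rightarrow> real" where
  "enorm v = sqrt (v \<bullet> v)"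

text \<open>
  Taking the supremum over the closed unit ball, rather than the unit sphere, makes the spectral
  norm of a matrix without columns equal to 0.
\<close>

definition spectral_norm :: "real mat \<Rightarrow> real" where
  "spectral_norm M = (SUP v\<in>{v \<in> carrier_vec (dim_col M). enorm v \<le> 1}. enorm (M *\<^sub>v v))"

text \<open>The four Penrose conditions.\<close>

definition is_pinv :: "real mat \<Rightarrow> real mat \<Rightarrow> bool" where
  "is_pinv M X \<longleftrightarrow>
     X \<in> carrier_mat (dim_col M) (dim_row M) \<and>
     M * X * M = M \<and>
     X * M * X = X \<and>
     transpose_mat (M * X) = M * X \<and>
     transpose_mat (X * M) = X * M"

definition pinv :: "real mat \<Rightarrow> real mat" where
  "pinv M = (THE X. is_pinv M X)"

definition orthonormal_cols :: "real mat \<Rightarrow> bool" where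
  "orthonormal_cols M \<longleftrightarrow>
     (\<forall>i < dim_col M. \<forall>j < dim_col M. col M i \<bullet> col M j = (if i = j then 1 else 0))"

text \<open>
  One Gram-Schmidt step, without normalization, against the columns of \<open>V\<close> with index in \<open>I\<close>.
  Below, any columns that a vector is orthogonalized against are mutually orthonormal, because they
  lie within one window; so this is the orthogonal projection, and the classical and the modified
  Gram-Schmidt procedures agree.
\<close>

definition orthogonalize :: "real mat \<Rightarrow> nat set \<Rightarrow> real vec \<Rightarrow> real vec" where
  "orthogonalize V I v = v - finsum_vec TYPE(real) (dim_vec v) (\<lambda>i. (col V i \<bullet> v) \<cdot>\<^sub>v col V i) I"

definition normalize_vec :: "real vec \<Rightarrow> real vec" where
  "normalize_vec v = (1 / enorm v) \<cdot>\<^sub>v v"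

text \<open>
  \<open>partial_fgk A b \<tau> l k P W Z\<close>: \<open>k\<close> steps of the flexible Golub-Kahan process with orthogonalization
  window \<open>l\<close> run without breakdown and produce \<open>P = [p\<^sub>1, \<dots>, p\<^sub>k]\<close>, \<open>W = [w\<^sub>1, \<dots>, w\<^sub>k\<^sub>+\<^sub>1]\<close> and
  \<open>Z = [z\<^sub>1, \<dots>, z\<^sub>k]\<close>. Columns are indexed from 0, so \<open>p\<^sub>i\<close> is \<open>col P (i - 1)\<close>; the subtraction \<open>j - l\<close>
  of natural numbers is truncated at 0, the index of the first column.
\<close>

definition partial_fgk ::
  "real mat \<Rightarrow> real vec \<Rightarrow> (real vec \<Rightarrow> real vec) \<Rightarrow> nat \<Rightarrow> nat \<Rightarrow> real mat \<Rightarrow> real mat \<Rightarrow> real mat \<Rightarrow> bool"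
where
  "partial_fgk A b \<tau> l k P W Z \<longleftrightarrow>
     P \<in> carrier_mat (dim_col A) k \<and>
     W \<in> carrier_mat (dim_row A) (k + 1) \<and>
     Z \<in> carrier_mat (dim_col A) k \<and>
     col W 0 = normalize_vec b \<and>
     (\<forall>j < k.
        let p = orthogonalize P {j - l..<j} (transpose_mat A *\<^sub>v col W j);
            w = orthogonalize W {j - l..j} (A *\<^sub>v col Z j)
        in p \<noteq> 0\<^sub>v (dim_col A) \<and> col P j = normalize_vec p \<and>
           col Z j = \<tau> (col P j) \<and>
           w \<noteq> 0\<^sub>v (dim_row A) \<and> col W (j + 1) = normalize_vec w)"

definition opt_residual :: "real mat \<Rightarrow> real vec \<Rightarrow> real mat \<Rightarrow> real" where
  "opt_residual A b Z =
     (LEAST r. r \<in> (\<lambda>y. enorm (A * Z *\<^sub>v y - b)) ` carrier_vec (dim_col Z))"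

definition sFLSQR_coeff :: "real mat \<Rightarrow> real mat \<Rightarrow> real vec \<Rightarrow> real mat \<Rightarrow> real vec" where
  "sFLSQR_coeff S A b Z =
     arg_min_on (\<lambda>y. enorm (S *\<^sub>v (A * Z *\<^sub>v y - b))) (carrier_vec (dim_col Z))"

definition sFLSMR_coeff :: "real mat \<Rightarrow> real mat \<Rightarrow> real vec \<Rightarrow> real mat \<Rightarrow> real vec" where
  "sFLSMR_coeff S A b Z =
     arg_min_on (\<lambda>y. enorm (S *\<^sub>v (transpose_mat A * A * Z *\<^sub>v y - transpose_mat A *\<^sub>v b)))
       (carrier_vec (dim_col Z))"

definition sFLSQR_residual :: "real mat \<Rightarrow> real mat \<Rightarrow> real vec \<Rightarrow> real mat \<Rightarrow> real" where
  "sFLSQR_residual S A b Z = enorm (A * Z *\<^sub>v sFLSQR_coeff S A b Z - b)"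

definition sFLSMR_residual :: "real mat \<Rightarrow> real mat \<Rightarrow> real vec \<Rightarrow> real mat \<Rightarrow> real" where
  "sFLSMR_residual S A b Z = enorm (A * Z *\<^sub>v sFLSMR_coeff S A b Z - b)"

end

theory Submission
  imports Defs
begin

text \<open>
  Both methods are instances of one situation. Write \<open>C = A Z\<close>, and let \<open>M\<close> be \<open>S\<close> for sFLSQR and
  \<open>S' A\<^sup>T\<close> for sFLSMR. The coefficient vector minimizes \<open>\<parallel>M (C y - b)\<parallel>\<close>, and \<open>M C\<close> has full column
  rank, so \<open>M\<close> is injective on the range of \<open>C\<close>, which is the range of \<open>Q\<close>. Hence \<open>M Q\<close> has full
  column rank as well, and \<open>X = (M Q)\<^sup>\<dagger>\<close> is a left inverse of \<open>M Q\<close>.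

  Split \<open>b = Q a + Q\<^sub>\<perp> u\<close>. By Pythagoras, \<open>\<parallel>Q x - b\<parallel>\<^sup>2 = \<parallel>x - a\<parallel>\<^sup>2 + \<parallel>u\<parallel>\<^sup>2\<close>, so the optimal residual
  norm is \<open>\<parallel>u\<parallel>\<close>. In the coordinates of \<open>Q\<close>, the solution of the sketched problem is \<open>x = X M b\<close>.
  Since \<open>X\<close> undoes \<open>M Q\<close>, this is \<open>x = a + X M Q\<^sub>\<perp> u\<close>: the sketch recovers \<open>a\<close>, up to the error that
  the sketch feeds back from \<open>Q\<^sub>\<perp> u\<close> into the range. The residual norm is therefore
  \<open>sqrt (\<parallel>X M Q\<^sub>\<perp> u\<parallel>\<^sup>2 + \<parallel>u\<parallel>\<^sup>2)\<close>, which the spectral norm of \<open>X M Q\<^sub>\<perp>\<close> bounds. This is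
  \<open>sketched_least_squares_bound\<close>.
\<close>

section \<open>The Euclidean norm\<close>

lemma scalar_prod_self_ge_0: "(v :: real vec) \<bullet> v \<ge> 0"
  by (simp add: scalar_prod_def sum_nonneg)

lemma enorm_ge_0: "enorm v \<ge> 0"
  by (simp add: enorm_def scalar_prod_self_ge_0)

lemma enorm_sq: "(enorm v)\<^sup>2 = v \<bullet> v"
  by (simp add: enorm_def scalar_prod_self_ge_0)

lemma enorm_smult: "enorm (c \<cdot>\<^sub>v v) = \<bar>c\<bar> * enorm v"
  by (simp add: enorm_def real_sqrt_mult mult.assoc[symmetric])

lemma scalar_prod_self_eq_0:
  assumes "(v :: real vec) \<in> carrier_vec n" "v \<bullet> v = 0"
  shows "v = 0\<^sub>v n"
proof (rule eq_vecI)
  fix i assume i: "i < dim_vec (0\<^sub>v n :: real vec)"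
  have "\<forall>i\<in>{0..<n}. v $ i * v $ i = 0"
    using assms by (subst sum_nonneg_eq_0_iff[symmetric]) (auto simp: scalar_prod_def)
  then show "v $ i = (0\<^sub>v n :: real vec) $ i" using i by simp
qed (use assms in auto)

lemma abs_component_le_enorm:
  assumes "i < dim_vec v"
  shows "\<bar>v $ i\<bar> \<le> enorm v"
proof -
  have "(v $ i)\<^sup>2 \<le> (\<Sum>j\<in>{0..<dim_vec v}. v $ j * v $ j)"
    using assms member_le_sum[of i "{0..<dim_vec v}" "\<lambda>j. v $ j * v $ j"]
    by (simp add: power2_eq_square)
  then show ?thesis
    unfolding enorm_def scalar_prod_def by (metis real_sqrt_abs real_sqrt_le_mono)
qed

lemma enorm_sq_add:
  assumes "u \<in> carrier_vec n" "v \<in> carrier_vec n" "u \<bullet> v = 0"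
  shows "(enorm (u + v))\<^sup>2 = (enorm u)\<^sup>2 + (enorm v)\<^sup>2"
proof -
  have "v \<bullet> u = 0" using assms comm_scalar_prod[of u n v] by simp
  then show ?thesis
    using assms by (simp add: enorm_sq add_scalar_prod_distrib[of _ n] scalar_prod_add_distrib[of _ n])
qed

lemma scalar_prod_mult_mat_vec_0:
  fixes N :: "real mat"
  assumes "N \<in> carrier_mat s k" "v \<in> carrier_vec k" "w \<in> carrier_vec s"
    and "transpose_mat N *\<^sub>v w = 0\<^sub>v k"
  shows "(N *\<^sub>v v) \<bullet> w = 0"
proof -
  have "(N *\<^sub>v v) \<bullet> w = w \<bullet> (N *\<^sub>v v)" using assms by (intro comm_scalar_prod[of _ s]) auto
  also have "\<dots> = (transpose_mat N *\<^sub>v w) \<bullet> v"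
    using transpose_vec_mult_scalar[OF assms(1,2,3)] by simp
  finally show ?thesis using assms by simp
qed


section \<open>The spectral norm\<close>

text \<open>
  On the unit ball every component of a vector is at most 1 in absolute value, so the row sums of
  the absolute values bound the components of \<open>M v\<close>. This crude bound is enough for the supremum
  in the spectral norm to be a genuine one.
\<close>

lemma bdd_above_spectral_norm:
  "bdd_above ((\<lambda>v. enorm (M *\<^sub>v v)) ` {v \<in> carrier_vec (dim_col M). enorm v \<le> 1})"
proof (rule bdd_aboveI2)
  fix v assume v: "v \<in> {v \<in> carrier_vec (dim_col M). enorm v \<le> 1}"
  let ?R = "\<lambda>i. \<Sum>j\<in>{0..<dim_col M}. \<bar>M $$ (i, j)\<bar>"
  have comp: "\<bar>v $ j\<bar> \<le> 1" if "j < dim_col M" for j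
    using v that abs_component_le_enorm[of j v] by auto
  have row: "\<bar>(M *\<^sub>v v) $ i\<bar> \<le> ?R i" if i: "i < dim_row M" for i
  proof -
    have "\<bar>(M *\<^sub>v v) $ i\<bar> = \<bar>\<Sum>j\<in>{0..<dim_col M}. M $$ (i, j) * v $ j\<bar>"
      using i v by (auto simp: scalar_prod_def intro!: arg_cong[of _ _ abs] sum.cong)
    also have "\<dots> \<le> (\<Sum>j\<in>{0..<dim_col M}. \<bar>M $$ (i, j) * v $ j\<bar>)" by (rule sum_abs)
    also have "\<dots> \<le> ?R i"
      by (rule sum_mono) (use comp in \<open>auto simp: abs_mult intro: mult_left_le\<close>)
    finally show ?thesis .
  qed
  have "(M *\<^sub>v v) \<bullet> (M *\<^sub>v v) = (\<Sum>i\<in>{0..<dim_row M}. ((M *\<^sub>v v) $ i)\<^sup>2)"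
    by (simp add: scalar_prod_def power2_eq_square)
  also have "\<dots> \<le> (\<Sum>i\<in>{0..<dim_row M}. (?R i)\<^sup>2)"
  proof (rule sum_mono)
    fix i assume "i \<in> {0..<dim_row M}"
    then have "\<bar>(M *\<^sub>v v) $ i\<bar> \<le> \<bar>?R i\<bar>"
      by (intro order_trans[OF row abs_ge_self]) simp
    then show "((M *\<^sub>v v) $ i)\<^sup>2 \<le> (?R i)\<^sup>2" by (simp only: abs_le_square_iff)
  qed
  finally show "enorm (M *\<^sub>v v) \<le> sqrt (\<Sum>i\<in>{0..<dim_row M}. (?R i)\<^sup>2)"
    unfolding enorm_def by (rule real_sqrt_le_mono)
qed

lemma enorm_mult_mat_vec_le:
  assumes M: "M \<in> carrier_mat r c" and v: "v \<in> carrier_vec c"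
  shows "enorm (M *\<^sub>v v) \<le> spectral_norm M * enorm v"
proof (cases "enorm v = 0")
  case True
  then have "v = 0\<^sub>v c"
    using v scalar_prod_self_eq_0[of v c] enorm_sq[of v] by simp
  then have "M *\<^sub>v v = 0\<^sub>v r" using M by auto
  then show ?thesis using True by (simp add: enorm_def)
next
  case False
  then have pos: "enorm v > 0" using enorm_ge_0[of v] by simp
  let ?w = "(1 / enorm v) \<cdot>\<^sub>v v"
  have "?w \<in> {v \<in> carrier_vec (dim_col M). enorm v \<le> 1}"
    using M v pos by (simp add: enorm_smult)
  then have "enorm (M *\<^sub>v ?w) \<le> spectral_norm M"
    unfolding spectral_norm_def by (rule cSUP_upper[OF _ bdd_above_spectral_norm])
  moreover have "enorm (M *\<^sub>v ?w) = enorm (M *\<^sub>v v) / enorm v"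
    using pos by (simp add: mult_mat_vec[OF M v] enorm_smult)
  ultimately show ?thesis using pos by (simp add: field_simps)
qed


section \<open>Full column rank and the pseudoinverse\<close>

lemma full_column_rank_imp_injective:
  fixes N :: "real mat"
  assumes N: "N \<in> carrier_mat s k" and rank: "vec_space.rank s N = k"
    and v: "v \<in> carrier_vec k" "N *\<^sub>v v = 0\<^sub>v s"
  shows "v = 0\<^sub>v k"
proof -
  interpret vec_space "TYPE(real)" s .
  have "distinct (cols N)"
  proof (rule ccontr)
    assume ndist: "\<not> distinct (cols N)"
    obtain U where U: "maximal U (\<lambda>T. T \<subseteq> set (cols N) \<and> lin_indpt T)"
      using maximal_exists[of "\<lambda>T. T \<subseteq> set (cols N) \<and> lin_indpt T" "card (set (cols N))" "{}"]
      by (meson List.finite_set card_mono empty_iff empty_subsetI finite_lin_indpt2 rev_finite_subset)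
    have "rank N = card U" by (rule rank_card_indpt[OF N U])
    also have "\<dots> \<le> card (set (cols N))" using U by (simp add: card_mono maximal_def)
    also have "\<dots> < length (cols N)"
      using ndist card_length[of "cols N"] card_distinct[of "cols N"] by linarith
    finally show False using rank N by simp
  qed
  then show ?thesis
    using lin_depI[OF N v(1) _ v(2)] full_rank_lin_indpt[OF N rank] by blast
qed

text \<open>
  For two pseudoinverses \<open>X\<close> and \<open>Y\<close>, both \<open>M X\<close> and \<open>M Y\<close> are the orthogonal projection onto the
  range of \<open>M\<close>: each of these projections absorbs the other, and symmetry makes them equal. The
  same holds for \<open>X M\<close> and \<open>Y M\<close>.
\<close>

lemma is_pinv_unique:
  assumes X: "is_pinv M X" and Y: "is_pinv M Y"
  shows "X = Y"
proof -
  obtain r c where M: "M \<in> carrier_mat r c" by auto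
  have cX: "X \<in> carrier_mat c r" and cY: "Y \<in> carrier_mat c r"
    using X Y M by (auto simp: is_pinv_def)
  have MX: "M * X = M * Y"
  proof -
    have "M * X = (M * Y * M) * X" using Y by (simp add: is_pinv_def)
    also have "\<dots> = (M * Y) * (M * X)" by (rule assoc_mult_mat) (use M cX cY in auto)
    also have "\<dots> = transpose_mat (M * Y) * transpose_mat (M * X)"
      using X Y by (simp add: is_pinv_def)
    also have "\<dots> = transpose_mat ((M * X) * (M * Y))"
      by (rule transpose_mult[symmetric]) (use M cX cY in auto)
    also have "(M * X) * (M * Y) = (M * X * M) * Y"
      by (rule assoc_mult_mat[symmetric]) (use M cX cY in auto)
    also have "\<dots> = M * Y" using X by (simp add: is_pinv_def)
    finally show ?thesis using Y by (simp add: is_pinv_def)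
  qed
  have XM: "X * M = Y * M"
  proof -
    have "X * M = X * (M * Y * M)" using Y by (simp add: is_pinv_def)
    also have "M * Y * M = M * (Y * M)" by (rule assoc_mult_mat) (use M cX cY in auto)
    also have "X * (M * (Y * M)) = (X * M) * (Y * M)"
      by (rule assoc_mult_mat[symmetric]) (use M cX cY in auto)
    also have "\<dots> = transpose_mat (X * M) * transpose_mat (Y * M)"
      using X Y by (simp add: is_pinv_def)
    also have "\<dots> = transpose_mat ((Y * M) * (X * M))"
      by (rule transpose_mult[symmetric]) (use M cX cY in auto)
    also have "(Y * M) * (X * M) = Y * (M * (X * M))"
      by (rule assoc_mult_mat) (use M cX cY in auto)
    also have "M * (X * M) = M * X * M"
      by (rule assoc_mult_mat[symmetric]) (use M cX cY in auto)
    also have "M * X * M = M" using X by (simp add: is_pinv_def)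
    finally show ?thesis using Y by (simp add: is_pinv_def)
  qed
  have "X = X * M * X" using X by (simp add: is_pinv_def)
  also have "\<dots> = Y * (M * X)" using assoc_mult_mat[OF cY M cX] XM by simp
  also have "\<dots> = Y * M * Y" using assoc_mult_mat[OF cY M cY] MX by simp
  also have "\<dots> = Y" using Y by (simp add: is_pinv_def)
  finally show ?thesis .
qed

text \<open>
  The pseudoinverse of an injective matrix \<open>N\<close> is \<open>(N\<^sup>T N)\<^sup>-\<^sup>1 N\<^sup>T\<close>. The Gram matrix \<open>N\<^sup>T N\<close> is
  invertible because \<open>N\<^sup>T N v = 0\<close> forces \<open>\<parallel>N v\<parallel>\<^sup>2 = v \<bullet> N\<^sup>T N v = 0\<close>.
\<close>

lemma is_pinv_pinv:
  assumes N: "N \<in> carrier_mat s k"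
    and inj: "\<And>v. v \<in> carrier_vec k \<Longrightarrow> N *\<^sub>v v = 0\<^sub>v s \<Longrightarrow> v = 0\<^sub>v k"
  shows "is_pinv N (pinv N)"
proof -
  let ?T = "transpose_mat N" and ?G = "transpose_mat N * N"
  have T: "?T \<in> carrier_mat k s" and G: "?G \<in> carrier_mat k k" using N by auto
  have "det ?G \<noteq> 0"
  proof
    assume "det ?G = 0"
    then obtain v where v: "v \<in> carrier_vec k" "v \<noteq> 0\<^sub>v k" "?G *\<^sub>v v = 0\<^sub>v k"
      using det_0_iff_vec_prod_zero_field[OF G] by auto
    have Nv: "N *\<^sub>v v \<in> carrier_vec s" using N v by auto
    have "?T *\<^sub>v (N *\<^sub>v v) = 0\<^sub>v k" using v assoc_mult_mat_vec[OF T N v(1)] by simp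
    then have "(N *\<^sub>v v) \<bullet> (N *\<^sub>v v) = 0" by (rule scalar_prod_mult_mat_vec_0[OF N v(1) Nv])
    then show False using scalar_prod_self_eq_0[OF Nv] inj[OF v(1)] v(2) by blast
  qed
  then obtain B where B: "B \<in> carrier_mat k k" "B * ?G = 1\<^sub>m k" "?G * B = 1\<^sub>m k"
    using det_non_zero_imp_unit[OF G, of "()"] by (auto simp: Units_def ring_mat_def)
  have TG: "transpose_mat ?G = ?G" using transpose_mult[OF T N] by simp
  have TB: "transpose_mat B = B"
  proof -
    have TBc: "transpose_mat B \<in> carrier_mat k k" using B by auto
    have "transpose_mat B * ?G = 1\<^sub>m k"
      using transpose_mult[OF G B(1)] B(3) TG by simp
    then have "transpose_mat B * ?G * B = B" using B by simp
    then show ?thesis using assoc_mult_mat[OF TBc G B(1)] B(3) TBc by simp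
  qed
  let ?X = "B * ?T"
  have X: "?X \<in> carrier_mat k s" using B T by auto
  have XN: "?X * N = 1\<^sub>m k" using assoc_mult_mat[OF B(1) T N] B by simp
  have "transpose_mat (N * ?X) = transpose_mat ?X * ?T" by (rule transpose_mult[OF N X])
  also have "transpose_mat ?X = N * B" using transpose_mult[OF B(1) T] TB by simp
  also have "N * B * ?T = N * ?X" by (rule assoc_mult_mat[OF N B(1) T])
  finally have sym: "transpose_mat (N * ?X) = N * ?X" .
  have NXN: "N * ?X * N = N"
    unfolding assoc_mult_mat[OF N X N] XN by (rule right_mult_one_mat[OF N])
  have XNX: "?X * N * ?X = ?X"
    unfolding XN by (rule left_mult_one_mat[OF X])
  have "?X \<in> carrier_mat (dim_col N) (dim_row N)" using N X by blast
  moreover have "transpose_mat (?X * N) = ?X * N" unfolding XN by simp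
  ultimately have pinv: "is_pinv N ?X"
    using NXN XNX sym unfolding is_pinv_def by blast
  then show ?thesis
    unfolding pinv_def by (rule theI) (rule is_pinv_unique[OF _ pinv])
qed

text \<open>
  Injectivity cancels the left factor in \<open>N (X N) = N\<close>, and transposing the same identity shows that
  \<open>X c\<close> solves the normal equations: these are the only two properties of the pseudoinverse that a
  least-squares problem of full column rank involves.
\<close>

lemma pinv_injective:
  assumes N: "N \<in> carrier_mat s k"
    and inj: "\<And>v. v \<in> carrier_vec k \<Longrightarrow> N *\<^sub>v v = 0\<^sub>v s \<Longrightarrow> v = 0\<^sub>v k"
  shows "pinv N \<in> carrier_mat k s"
    and "v \<in> carrier_vec k \<Longrightarrow> pinv N *\<^sub>v (N *\<^sub>v v) = v"
    and "c \<in> carrier_vec s \<Longrightarrow> transpose_mat N *\<^sub>v (N *\<^sub>v (pinv N *\<^sub>v c) - c) = 0\<^sub>v k"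
proof -
  let ?X = "pinv N" and ?T = "transpose_mat N"
  have pinv: "is_pinv N ?X" using is_pinv_pinv[OF N inj] .
  have T: "?T \<in> carrier_mat k s" using N by simp
  show X: "?X \<in> carrier_mat k s" using pinv N by (auto simp: is_pinv_def)
  have NX: "N * ?X \<in> carrier_mat s s" using N X by simp
  show "?X *\<^sub>v (N *\<^sub>v v) = v" if v: "v \<in> carrier_vec k"
  proof -
    have Nv: "N *\<^sub>v v \<in> carrier_vec s" using N v by auto
    have XNv: "?X *\<^sub>v (N *\<^sub>v v) \<in> carrier_vec k" using X Nv by auto
    have "N *\<^sub>v (?X *\<^sub>v (N *\<^sub>v v)) = (N * ?X * N) *\<^sub>v v"
      using assoc_mult_mat_vec[OF N X Nv] assoc_mult_mat_vec[OF NX N v] by simp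
    also have "\<dots> = N *\<^sub>v v" using pinv by (simp add: is_pinv_def)
    finally have "N *\<^sub>v (?X *\<^sub>v (N *\<^sub>v v) - v) = 0\<^sub>v s"
      using mult_minus_distrib_mat_vec[OF N XNv v] Nv by simp
    then have "?X *\<^sub>v (N *\<^sub>v v) - v = 0\<^sub>v k" using inj XNv v by simp
    then have "?X *\<^sub>v (N *\<^sub>v v) - v + v = 0\<^sub>v k + v" by simp
    then show ?thesis using XNv v by (simp add: minus_add_uminus_vec[of _ k])
  qed
  show "?T *\<^sub>v (N *\<^sub>v (?X *\<^sub>v c) - c) = 0\<^sub>v k" if c: "c \<in> carrier_vec s"
  proof -
    have Xc: "?X *\<^sub>v c \<in> carrier_vec k" using X c by auto
    have "?T * (N * ?X) = ?T * transpose_mat (N * ?X)" using pinv by (simp add: is_pinv_def)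
    also have "\<dots> = transpose_mat (N * ?X * N)" by (rule transpose_mult[OF NX N, symmetric])
    also have "N * ?X * N = N" using pinv by (simp add: is_pinv_def)
    finally have "?T *\<^sub>v ((N * ?X) *\<^sub>v c) = ?T *\<^sub>v c"
      using assoc_mult_mat_vec[OF T NX c] by simp
    then have eq: "?T *\<^sub>v (N *\<^sub>v (?X *\<^sub>v c)) = ?T *\<^sub>v c"
      using assoc_mult_mat_vec[OF N X c] by simp
    have "N *\<^sub>v (?X *\<^sub>v c) \<in> carrier_vec s" using N Xc by auto
    then show ?thesis
      using mult_minus_distrib_mat_vec[OF T _ c] eq T c by simp
  qed
qed


section \<open>Least squares by the normal equations\<close>

text \<open>
  At a solution \<open>x\<^sub>0\<close> of the normal equations the residual is orthogonal to the range of \<open>N\<close>, so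
  \<open>\<parallel>N x - c\<parallel>\<^sup>2 = \<parallel>N (x - x\<^sub>0)\<parallel>\<^sup>2 + \<parallel>N x\<^sub>0 - c\<parallel>\<^sup>2\<close>, and by injectivity \<open>x\<^sub>0\<close> is the only minimizer. The
  uniqueness identifies the minimizer that the choice operator picks.
\<close>

lemma arg_min_on_least_squares:
  assumes N: "N \<in> carrier_mat s k"
    and inj: "\<And>v. v \<in> carrier_vec k \<Longrightarrow> N *\<^sub>v v = 0\<^sub>v s \<Longrightarrow> v = 0\<^sub>v k"
    and c: "c \<in> carrier_vec s" and x0: "x0 \<in> carrier_vec k"
    and normal: "transpose_mat N *\<^sub>v (N *\<^sub>v x0 - c) = 0\<^sub>v k"
  shows "arg_min_on (\<lambda>x. enorm (N *\<^sub>v x - c)) (carrier_vec k) = x0"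
proof -
  have Nx0: "N *\<^sub>v x0 \<in> carrier_vec s" using N x0 by auto
  have split: "(enorm (N *\<^sub>v x - c))\<^sup>2 = (enorm (N *\<^sub>v (x - x0)))\<^sup>2 + (enorm (N *\<^sub>v x0 - c))\<^sup>2"
    if x: "x \<in> carrier_vec k" for x
  proof -
    have Nx: "N *\<^sub>v x \<in> carrier_vec s" using N x by auto
    have d: "N *\<^sub>v (x - x0) = N *\<^sub>v x - N *\<^sub>v x0" by (rule mult_minus_distrib_mat_vec[OF N x x0])
    have "N *\<^sub>v x - c = N *\<^sub>v (x - x0) + (N *\<^sub>v x0 - c)"
      unfolding d using N Nx Nx0 c by (intro eq_vecI) auto
    moreover have "(N *\<^sub>v (x - x0)) \<bullet> (N *\<^sub>v x0 - c) = 0"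
      by (rule scalar_prod_mult_mat_vec_0[OF N _ _ normal]) (use x x0 Nx0 c in auto)
    moreover have "N *\<^sub>v (x - x0) \<in> carrier_vec s" "N *\<^sub>v x0 - c \<in> carrier_vec s"
      using d Nx Nx0 c by auto
    ultimately show ?thesis using enorm_sq_add by metis
  qed
  have min: "enorm (N *\<^sub>v x0 - c) \<le> enorm (N *\<^sub>v x - c)" if "x \<in> carrier_vec k" for x
    by (rule power2_le_imp_le) (use split[OF that] enorm_ge_0 in auto)
  show ?thesis
    unfolding arg_min_on_def arg_min_def is_arg_min_def
  proof (rule some_equality)
    show "x0 \<in> carrier_vec k \<and>
        (\<nexists>y. y \<in> carrier_vec k \<and> enorm (N *\<^sub>v y - c) < enorm (N *\<^sub>v x0 - c))"
      using x0 min by (auto simp: not_less)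
  next
    fix x
    assume "x \<in> carrier_vec k \<and>
        (\<nexists>y. y \<in> carrier_vec k \<and> enorm (N *\<^sub>v y - c) < enorm (N *\<^sub>v x - c))"
    then have x: "x \<in> carrier_vec k" and le: "enorm (N *\<^sub>v x - c) \<le> enorm (N *\<^sub>v x0 - c)"
      using x0 by (auto simp: not_less)
    have d: "N *\<^sub>v (x - x0) \<in> carrier_vec s" using N x x0 by auto
    have "(enorm (N *\<^sub>v x - c))\<^sup>2 \<le> (enorm (N *\<^sub>v x0 - c))\<^sup>2"
      using le enorm_ge_0 by (intro power_mono) auto
    then have "(enorm (N *\<^sub>v (x - x0)))\<^sup>2 = 0"
      using split[OF x] zero_le_power2[of "enorm (N *\<^sub>v (x - x0))"] by linarith
    then have "N *\<^sub>v (x - x0) = 0\<^sub>v s" using scalar_prod_self_eq_0[OF d] by (simp only: enorm_sq)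
    then have "x - x0 = 0\<^sub>v k" using inj x x0 by simp
    then have "x - x0 + x0 = 0\<^sub>v k + x0" by simp
    then show "x = x0" using x x0 by (simp add: minus_add_uminus_vec[of _ k])
  qed
qed


section \<open>Orthonormal bases of a column space and of its complement\<close>

lemma mem_col_space_iff:
  fixes M :: "real mat"
  assumes "M \<in> carrier_mat r c"
  shows "y \<in> vec_space.col_space r M \<longleftrightarrow> (\<exists>x\<in>carrier_vec c. y = M *\<^sub>v x)"
  using assms by (auto simp: vec_space.col_space_eq[OF assms])

lemma orthonormal_cols_transpose_mult:
  assumes "Q \<in> carrier_mat m q" "orthonormal_cols Q"
  shows "transpose_mat Q * Q = 1\<^sub>m q"
  using assms by (intro eq_matI) (auto simp: orthonormal_cols_def)

lemma orthonormal_cols_scalar_prod: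
  assumes Q: "Q \<in> carrier_mat m q" "orthonormal_cols Q"
    and x: "x \<in> carrier_vec q" and y: "y \<in> carrier_vec q"
  shows "(Q *\<^sub>v x) \<bullet> (Q *\<^sub>v y) = x \<bullet> y"
proof -
  have T: "transpose_mat Q \<in> carrier_mat q m" and Qx: "Q *\<^sub>v x \<in> carrier_vec m"
    using Q x by auto
  have "(Q *\<^sub>v x) \<bullet> (Q *\<^sub>v y) = (transpose_mat Q *\<^sub>v (Q *\<^sub>v x)) \<bullet> y"
    using transpose_vec_mult_scalar[OF Q(1) y Qx] by simp
  also have "transpose_mat Q *\<^sub>v (Q *\<^sub>v x) = x"
    using assoc_mult_mat_vec[OF T Q(1) x] orthonormal_cols_transpose_mult[OF Q] x by simp
  finally show ?thesis .
qed

locale orthonormal_splitting =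
  fixes m q d :: nat and Q Qp :: "real mat"
  assumes Q: "Q \<in> carrier_mat m q" "orthonormal_cols Q"
    and Qp: "Qp \<in> carrier_mat m d" "orthonormal_cols Qp"
    and complement: "vec_space.col_space m Qp =
      vec_module.orthogonal_complement m (vec_space.col_space m Q)"
begin

lemma enorm_sq_diff:
  assumes x: "x \<in> carrier_vec q" and u: "u \<in> carrier_vec d"
  shows "(enorm (Q *\<^sub>v x - Qp *\<^sub>v u))\<^sup>2 = (enorm x)\<^sup>2 + (enorm u)\<^sup>2"
proof -
  have Qx: "Q *\<^sub>v x \<in> carrier_vec m" and Qpu: "Qp *\<^sub>v u \<in> carrier_vec m"
    using Q Qp x u by auto
  have "Qp *\<^sub>v u \<in> vec_module.orthogonal_complement m (vec_space.col_space m Q)"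
    unfolding complement[symmetric] using u mem_col_space_iff[OF Qp(1)] by blast
  then have "(Qp *\<^sub>v u) \<bullet> (Q *\<^sub>v x) = 0"
    unfolding vec_module.orthogonal_complement_def using x mem_col_space_iff[OF Q(1)] by blast
  then have "(enorm (Q *\<^sub>v x + - (Qp *\<^sub>v u)))\<^sup>2 = (enorm (Q *\<^sub>v x))\<^sup>2 + (enorm (- (Qp *\<^sub>v u)))\<^sup>2"
    using Q(1) Qp(1) Qx Qpu comm_scalar_prod[OF Qx Qpu] by (intro enorm_sq_add) auto
  then show ?thesis
    using minus_add_uminus_vec[OF Qx Qpu] Qpu
      orthonormal_cols_scalar_prod[OF Q x x] orthonormal_cols_scalar_prod[OF Qp u u]
    by (simp add: enorm_sq)
qed

lemma obtain_splitting:
  assumes b: "b \<in> carrier_vec m"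
  obtains a u where "a \<in> carrier_vec q" "u \<in> carrier_vec d" "b = Q *\<^sub>v a + Qp *\<^sub>v u"
proof -
  let ?a = "transpose_mat Q *\<^sub>v b"
  have T: "transpose_mat Q \<in> carrier_mat q m" using Q by simp
  have a: "?a \<in> carrier_vec q" using T b by auto
  have Qa: "Q *\<^sub>v ?a \<in> carrier_vec m" using Q a by auto
  let ?r = "b - Q *\<^sub>v ?a"
  have r: "?r \<in> carrier_vec m" by (rule minus_carrier_vec[OF b Qa])
  have "?r \<bullet> y = 0" if y_mem: "y \<in> vec_space.col_space m Q" for y
  proof -
    obtain x where x: "x \<in> carrier_vec q" and y: "y = Q *\<^sub>v x"
      using y_mem mem_col_space_iff[OF Q(1)] by blast
    have "?r \<bullet> y = b \<bullet> (Q *\<^sub>v x) - (Q *\<^sub>v ?a) \<bullet> (Q *\<^sub>v x)"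
      unfolding y using Q x by (intro minus_scalar_prod_distrib[OF b Qa]) auto
    also have "b \<bullet> (Q *\<^sub>v x) = ?a \<bullet> x" using transpose_vec_mult_scalar[OF Q(1) x b] by simp
    also have "(Q *\<^sub>v ?a) \<bullet> (Q *\<^sub>v x) = ?a \<bullet> x" by (rule orthonormal_cols_scalar_prod[OF Q a x])
    finally show ?thesis by simp
  qed
  then have "?r \<in> vec_space.col_space m Qp"
    unfolding complement vec_module.orthogonal_complement_def using r by blast
  then obtain u where u: "u \<in> carrier_vec d" "?r = Qp *\<^sub>v u"
    using mem_col_space_iff[OF Qp(1)] by blast
  have "b = Q *\<^sub>v ?a + ?r" using Q b Qa by (intro eq_vecI) auto
  then show thesis using that[OF a u(1)] u(2) by simp
qed

end


section \<open>The sketched least-squares bound\<close>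

text \<open>
  The solution \<open>x = (M Q)\<^sup>\<dagger> M b\<close> in the coordinates of \<open>Q\<close> is transported to a coefficient vector \<open>y\<close>
  with \<open>C y = Q x\<close>. As \<open>M C\<close> and \<open>M Q\<close> have the same range, \<open>y\<close> satisfies the normal equations of
  \<open>M C\<close>, so it is the sketched minimizer.
\<close>

lemma (in orthonormal_splitting) sketched_least_squares_bound:
  assumes M: "M \<in> carrier_mat s m" and C: "C \<in> carrier_mat m k" and b: "b \<in> carrier_vec m"
    and range: "vec_space.col_space m Q = vec_space.col_space m C"
    and rank: "vec_space.rank s (M * C) = k"
  shows "enorm (C *\<^sub>v arg_min_on (\<lambda>y. enorm (M *\<^sub>v (C *\<^sub>v y - b))) (carrier_vec k) - b)
    \<le> (LEAST r. r \<in> (\<lambda>y. enorm (C *\<^sub>v y - b)) ` carrier_vec k) *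
       sqrt (1 + (spectral_norm (pinv (M * Q) * (M * Qp)))\<^sup>2)"
proof -
  let ?N = "M * Q" and ?X = "pinv (M * Q)" and ?F = "pinv (M * Q) * (M * Qp)"
  have N: "?N \<in> carrier_mat s q" and MC: "M * C \<in> carrier_mat s k"
    and MQp: "M * Qp \<in> carrier_mat s d" and Mb: "M *\<^sub>v b \<in> carrier_vec s"
    using M Q C Qp b by auto
  have to_Q: "\<exists>x\<in>carrier_vec q. C *\<^sub>v y = Q *\<^sub>v x" if "y \<in> carrier_vec k" for y
    using that range mem_col_space_iff[OF Q(1)] mem_col_space_iff[OF C] by blast
  have to_C: "\<exists>y\<in>carrier_vec k. Q *\<^sub>v x = C *\<^sub>v y" if "x \<in> carrier_vec q" for x
    using that range mem_col_space_iff[OF Q(1)] mem_col_space_iff[OF C] by blast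
  have inj_MC: "y = 0\<^sub>v k" if "y \<in> carrier_vec k" "(M * C) *\<^sub>v y = 0\<^sub>v s" for y
    using full_column_rank_imp_injective[OF MC rank] that by blast
  have inj_N: "x = 0\<^sub>v q" if x: "x \<in> carrier_vec q" and 0: "?N *\<^sub>v x = 0\<^sub>v s" for x
  proof -
    obtain y where y: "y \<in> carrier_vec k" "Q *\<^sub>v x = C *\<^sub>v y" using to_C[OF x] by blast
    have "(M * C) *\<^sub>v y = 0\<^sub>v s"
      using 0 y assoc_mult_mat_vec[OF M C y(1)] assoc_mult_mat_vec[OF M Q(1) x] by simp
    then have "y = 0\<^sub>v k" by (rule inj_MC[OF y(1)])
    then have "Q *\<^sub>v x = 0\<^sub>v m" using y(2) C by auto
    then have "x \<bullet> x = 0" using orthonormal_cols_scalar_prod[OF Q x x] by simp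
    then show ?thesis by (rule scalar_prod_self_eq_0[OF x])
  qed
  have X: "?X \<in> carrier_mat q s"
    by (rule pinv_injective(1)[OF N]) (rule inj_N)
  have X_left: "?X *\<^sub>v (?N *\<^sub>v v) = v" if "v \<in> carrier_vec q" for v
    by (rule pinv_injective(2)[OF N]) (rule inj_N, assumption+, rule that)
  have X_normal: "transpose_mat ?N *\<^sub>v (?N *\<^sub>v (?X *\<^sub>v c) - c) = 0\<^sub>v q" if "c \<in> carrier_vec s" for c
    by (rule pinv_injective(3)[OF N]) (rule inj_N, assumption+, rule that)
  obtain a u where a: "a \<in> carrier_vec q" and u: "u \<in> carrier_vec d"
    and b_eq: "b = Q *\<^sub>v a + Qp *\<^sub>v u"
    using obtain_splitting[OF b] by blast
  have Qa: "Q *\<^sub>v a \<in> carrier_vec m" and Qpu: "Qp *\<^sub>v u \<in> carrier_vec m" using Q Qp a u by auto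
  have residual: "(enorm (Q *\<^sub>v x - b))\<^sup>2 = (enorm (x - a))\<^sup>2 + (enorm u)\<^sup>2"
    if x: "x \<in> carrier_vec q" for x
  proof -
    have "Q *\<^sub>v x - b = Q *\<^sub>v (x - a) - Qp *\<^sub>v u"
      unfolding b_eq mult_minus_distrib_mat_vec[OF Q(1) x a]
      using Q Qp x a u by (intro eq_vecI) auto
    then show ?thesis using enorm_sq_diff[of "x - a" u] x a u by simp
  qed
  have opt: "(LEAST r. r \<in> (\<lambda>y. enorm (C *\<^sub>v y - b)) ` carrier_vec k) = enorm u"
  proof (rule Least_equality)
    obtain y where y: "y \<in> carrier_vec k" "Q *\<^sub>v a = C *\<^sub>v y" using to_C[OF a] by blast
    have "(enorm (C *\<^sub>v y - b))\<^sup>2 = (enorm u)\<^sup>2"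
      using residual[OF a] y(2) a by (simp add: enorm_sq)
    then have "enorm (C *\<^sub>v y - b) = enorm u" using enorm_ge_0 by (simp add: power2_eq_iff_nonneg)
    then show "enorm u \<in> (\<lambda>y. enorm (C *\<^sub>v y - b)) ` carrier_vec k"
      using y by (metis imageI)
  next
    fix r assume "r \<in> (\<lambda>y. enorm (C *\<^sub>v y - b)) ` carrier_vec k"
    then obtain y where y: "y \<in> carrier_vec k" "r = enorm (C *\<^sub>v y - b)" by blast
    then obtain x where x: "x \<in> carrier_vec q" "C *\<^sub>v y = Q *\<^sub>v x" using to_Q by blast
    show "enorm u \<le> r"
      unfolding y(2) x(2) by (rule power2_le_imp_le) (use residual[OF x(1)] enorm_ge_0 in auto)
  qed
  define x where "x = ?X *\<^sub>v (M *\<^sub>v b)"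
  have x: "x \<in> carrier_vec q" using X Mb by (simp add: x_def)
  have F: "?F \<in> carrier_mat q d" using X MQp by simp
  have Fu: "?F *\<^sub>v u \<in> carrier_vec q" using F u by auto
  have x_eq: "x = a + ?F *\<^sub>v u"
  proof -
    have Na: "?N *\<^sub>v a \<in> carrier_vec s" and MQpu: "(M * Qp) *\<^sub>v u \<in> carrier_vec s"
      using N a MQp u by auto
    have "M *\<^sub>v b = ?N *\<^sub>v a + (M * Qp) *\<^sub>v u"
      unfolding b_eq mult_add_distrib_mat_vec[OF M Qa Qpu]
        assoc_mult_mat_vec[OF M Q(1) a] assoc_mult_mat_vec[OF M Qp(1) u] ..
    then have "x = ?X *\<^sub>v (?N *\<^sub>v a) + ?X *\<^sub>v ((M * Qp) *\<^sub>v u)"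
      unfolding x_def using mult_add_distrib_mat_vec[OF X Na MQpu] by simp
    then show ?thesis using X_left[OF a] assoc_mult_mat_vec[OF X MQp u] by simp
  qed
  obtain y where y: "y \<in> carrier_vec k" and Cy: "Q *\<^sub>v x = C *\<^sub>v y" using to_C[OF x] by blast
  have MCy: "(M * C) *\<^sub>v y = ?N *\<^sub>v x"
    using Cy assoc_mult_mat_vec[OF M C y] assoc_mult_mat_vec[OF M Q(1) x] by simp
  let ?w = "?N *\<^sub>v x - M *\<^sub>v b"
  have w: "?w \<in> carrier_vec s" using N x Mb by auto
  have "transpose_mat (M * C) *\<^sub>v ?w = 0\<^sub>v k"
  proof -
    let ?g = "transpose_mat (M * C) *\<^sub>v ?w"
    have g: "?g \<in> carrier_vec k" using MC w by auto
    \<comment> \<open>A vector of the form \<open>(M C)\<^sup>T w\<close> with \<open>w\<close> orthogonal to the range of \<open>M C\<close> is orthogonal to itself;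
       here \<open>w\<close> is orthogonal to the range of \<open>M Q\<close>, which is the same space.\<close>
    obtain z where z: "z \<in> carrier_vec q" "C *\<^sub>v ?g = Q *\<^sub>v z" using to_Q[OF g] by blast
    have "(M * C) *\<^sub>v ?g = ?N *\<^sub>v z"
      using z assoc_mult_mat_vec[OF M C g] assoc_mult_mat_vec[OF M Q(1) z(1)] by simp
    moreover have "?g \<bullet> ?g = ?w \<bullet> ((M * C) *\<^sub>v ?g)"
      by (rule transpose_vec_mult_scalar[OF MC g w])
    moreover have "?w \<bullet> (?N *\<^sub>v z) = (transpose_mat ?N *\<^sub>v ?w) \<bullet> z"
      by (rule transpose_vec_mult_scalar[OF N z(1) w, symmetric])
    moreover have "transpose_mat ?N *\<^sub>v ?w = 0\<^sub>v q"
      using X_normal[OF Mb] by (simp add: x_def)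
    ultimately have "?g \<bullet> ?g = 0" using z by simp
    then show ?thesis by (rule scalar_prod_self_eq_0[OF g])
  qed
  then have normal: "transpose_mat (M * C) *\<^sub>v ((M * C) *\<^sub>v y - M *\<^sub>v b) = 0\<^sub>v k"
    by (simp only: MCy)
  \<comment> \<open>The two objectives agree only on vectors of dimension \<open>k\<close>, so the congruence has to pass below
     \<open>arg_min_on\<close>, where the restriction to these vectors is visible.\<close>
  have "arg_min_on (\<lambda>y. enorm (M *\<^sub>v (C *\<^sub>v y - b))) (carrier_vec k)
      = arg_min_on (\<lambda>y. enorm ((M * C) *\<^sub>v y - M *\<^sub>v b)) (carrier_vec k)"
  proof -
    have "M *\<^sub>v (C *\<^sub>v y - b) = (M * C) *\<^sub>v y - M *\<^sub>v b" if "y \<in> carrier_vec k" for y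
    proof -
      have "C *\<^sub>v y \<in> carrier_vec m" using C that by auto
      then show ?thesis
        using mult_minus_distrib_mat_vec[OF M _ b] assoc_mult_mat_vec[OF M C that] by simp
    qed
    then show ?thesis
      unfolding arg_min_on_def arg_min_def is_arg_min_def by (intro arg_cong[of _ _ Eps] ext) auto
  qed
  also have "\<dots> = y" by (rule arg_min_on_least_squares[OF MC _ Mb y normal]) (rule inj_MC)
  finally have minimizer: "arg_min_on (\<lambda>y. enorm (M *\<^sub>v (C *\<^sub>v y - b))) (carrier_vec k) = y" .
  have "x - a = ?F *\<^sub>v u" unfolding x_eq using X a Fu by (intro eq_vecI) auto
  then have "(enorm (C *\<^sub>v y - b))\<^sup>2 = (enorm (?F *\<^sub>v u))\<^sup>2 + (enorm u)\<^sup>2"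
    using residual[OF x] by (simp only: Cy)
  also have "\<dots> \<le> (spectral_norm ?F * enorm u)\<^sup>2 + (enorm u)\<^sup>2"
    using enorm_mult_mat_vec_le[OF F u] enorm_ge_0 by (intro add_right_mono power_mono) auto
  also have "\<dots> = (enorm u * sqrt (1 + (spectral_norm ?F)\<^sup>2))\<^sup>2"
    by (simp add: power_mult_distrib algebra_simps)
  finally have "enorm (C *\<^sub>v y - b) \<le> enorm u * sqrt (1 + (spectral_norm ?F)\<^sup>2)"
    by (rule power2_le_imp_le) (simp add: enorm_ge_0)
  then show ?thesis unfolding minimizer opt .
qed

theorem theorem2p2:
  fixes A S S' P W Z Q Qp :: "real mat"
    and b :: "real vec"
    and \<tau> :: "real vec \<Rightarrow> real vec"
    and m n k s l q d :: nat
  assumes A: "A \<in> carrier_mat m n"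
    and b: "b \<in> carrier_vec m" "b \<noteq> 0\<^sub>v m"
    and ks: "k \<le> s" and sn: "s \<le> n"
    and tau: "\<tau> \<in> carrier_vec n \<rightarrow> carrier_vec n"
    and fgk: "partial_fgk A b \<tau> l k P W Z"
    and Q: "Q \<in> carrier_mat m q" "orthonormal_cols Q"
      "vec_space.col_space m Q = vec_space.col_space m (A * Z)"
    and Qp: "Qp \<in> carrier_mat m d" "orthonormal_cols Qp"
      "vec_space.col_space m Qp =
         vec_module.orthogonal_complement m (vec_space.col_space m (A * Z))"
    and S: "S \<in> carrier_mat s m"
    and S': "S' \<in> carrier_mat s n"
    and rank_S: "vec_space.rank s (S * A * Z) = k"
    and rank_S': "vec_space.rank s (S' * transpose_mat A * A * Z) = k"
  shows "sFLSQR_residual S A b Z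
      \<le> opt_residual A b Z * sqrt (1 + (spectral_norm (pinv (S * Q) * (S * Qp)))\<^sup>2)
    \<and> sFLSMR_residual S' A b Z
      \<le> opt_residual A b Z *
         sqrt (1 + (spectral_norm (pinv (S' * transpose_mat A * Q) * (S' * transpose_mat A * Qp)))\<^sup>2)"
proof -
  have Z: "Z \<in> carrier_mat n k" using fgk A by (simp add: partial_fgk_def)
  have C: "A * Z \<in> carrier_mat m k" using A Z by simp
  have T: "transpose_mat A \<in> carrier_mat n m" and M: "S' * transpose_mat A \<in> carrier_mat s m"
    using A S' by auto
  interpret splitting: orthonormal_splitting m q d Q Qp
    using Q Qp by unfold_locales auto
  have "vec_space.rank s (S * (A * Z)) = k"
    using rank_S assoc_mult_mat[OF S A Z] by simp
  from splitting.sketched_least_squares_bound[OF S C b(1) Q(3) this]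
  have lsqr: "sFLSQR_residual S A b Z
      \<le> opt_residual A b Z * sqrt (1 + (spectral_norm (pinv (S * Q) * (S * Qp)))\<^sup>2)"
    using Z by (simp add: sFLSQR_residual_def sFLSQR_coeff_def opt_residual_def)
  have "vec_space.rank s (S' * transpose_mat A * (A * Z)) = k"
    using rank_S' assoc_mult_mat[OF M A Z] by simp
  note bound = splitting.sketched_least_squares_bound[OF M C b(1) Q(3) this]
  have sketch: "S' *\<^sub>v (transpose_mat A * A * Z *\<^sub>v y - transpose_mat A *\<^sub>v b)
      = S' * transpose_mat A *\<^sub>v (A * Z *\<^sub>v y - b)" if y: "y \<in> carrier_vec k" for y
  proof -
    have Cy: "A * Z *\<^sub>v y \<in> carrier_vec m" using C y by auto
    have "transpose_mat A * A * Z *\<^sub>v y = transpose_mat A *\<^sub>v (A * Z *\<^sub>v y)"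
      using assoc_mult_mat[OF T A Z] assoc_mult_mat_vec[OF T C y] by simp
    then have "transpose_mat A * A * Z *\<^sub>v y - transpose_mat A *\<^sub>v b
        = transpose_mat A *\<^sub>v (A * Z *\<^sub>v y - b)"
      using mult_minus_distrib_mat_vec[OF T Cy b(1)] by simp
    moreover have "A * Z *\<^sub>v y - b \<in> carrier_vec m" using Cy b by auto
    ultimately show ?thesis using assoc_mult_mat_vec[OF S' T] by simp
  qed
  have "sFLSMR_coeff S' A b Z = arg_min_on
      (\<lambda>y. enorm (S' * transpose_mat A *\<^sub>v (A * Z *\<^sub>v y - b))) (carrier_vec k)"
    unfolding sFLSMR_coeff_def arg_min_on_def arg_min_def is_arg_min_def
    using Z sketch by (intro arg_cong[of _ _ Eps] ext) auto
  then have "sFLSMR_residual S' A b Z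
      \<le> opt_residual A b Z *
         sqrt (1 + (spectral_norm (pinv (S' * transpose_mat A * Q) * (S' * transpose_mat A * Qp)))\<^sup>2)"
    using bound Z by (simp add: sFLSMR_residual_def opt_residual_def)
  with lsqr show ?thesis ..
qed

end
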